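(* Let $G$ be a regular digraph with $v$ vertices and let $\Gamma$ be a transitive subtournament of size $s$ in $G$. Then $$s\le \frac{-3\theta_{\max}^2+\sqrt{9\theta_{\max}^4+4v^2+12\theta_{\max}^2v^2}}{2v},$$ where $\theta_{\max}$ is the maximum eigenvalue of the Seidel matrix of $G$.
   Context: A digraph $G=(V,E)$ has a finite vertex set $V$ and edge set $E\subseteq V\times V$. Its adjacency matrix $A$ is the $V\times V$ matrix with $A_{x,y}=1$ if $(x,y)\in E$ and $A_{x,y}=0$ otherwise. The Seidel matrix of $G$ is the Hermitian matrix $S_G=\sqrt{-1}(A-A^\top)$. The digraph is regular if there is $k$ such that $|\{x\in V:(x,y)\in E\}|=|\{x\in V:(y,x)\in E\}|=k$ for every $y\in V$. A tournament is a digraph with $A+A^\top=J-I$ ($J$ the all-one matrix, $I$ the identity). A transitive tournament is a tournament such that $(x,y)\in E$ and $(y,z)\in E$ imply $(x,z)\in E$. A transitive subtournament of size $s$ in $G$ is an induced sub-digraph of $G$ on $s$ vertices which is a transitive tournament. *)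

theory Defs
  imports
    "Graph_Theory.Pair_Digraph"
    "Graph_Theory.Digraph_Component"
    "Jordan_Normal_Form.Char_Poly"
begin

text \<open>
  A digraph with finite vertex set $V$ and edge set $E \subseteq V \times V$ is a
  \<^locale>\<open>pair_fin_digraph\<close>; loops and pairs of opposite edges are allowed.
\<close>

definition adj :: "'a pair_pre_digraph \<Rightarrow> 'a \<Rightarrow> 'a \<Rightarrow> complex" where
  "adj G x y = (if (x, y) \<in> parcs G then 1 else 0)"

definition regular_digraph :: "'a pair_pre_digraph \<Rightarrow> bool" where
  "regular_digraph G \<longleftrightarrow> (\<exists>k. \<forall>y \<in> pverts G.
     card {x \<in> pverts G. (x, y) \<in> parcs G} = k \<and>
     card {x \<in> pverts G. (y, x) \<in> parcs G} = k)"

text \<open>The matrix equation $A + A^T = J - I$, entry by entry.\<close>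

definition tournament :: "'a pair_pre_digraph \<Rightarrow> bool" where
  "tournament G \<longleftrightarrow> (\<forall>x \<in> pverts G. \<forall>y \<in> pverts G.
     adj G x y + adj G y x = 1 - (if x = y then 1 else 0))"

definition transitive_tournament :: "'a pair_pre_digraph \<Rightarrow> bool" where
  "transitive_tournament G \<longleftrightarrow> tournament G \<and>
     (\<forall>x y z. (x, y) \<in> parcs G \<and> (y, z) \<in> parcs G \<longrightarrow> (x, z) \<in> parcs G)"

definition transitive_subtournament ::
  "'a pair_pre_digraph \<Rightarrow> 'a pair_pre_digraph \<Rightarrow> bool" where
  "transitive_subtournament H G \<longleftrightarrow>
     induced_subgraph (with_proj H) (with_proj G) \<and> transitive_tournament H"

text \<open>
  Matrices of the library are indexed by initial segments of the natural numbers, so a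
  $V \times V$ matrix is read along a list \<open>vs\<close> of the vertices. A different list
  permutes rows and columns simultaneously, which does not affect the eigenvalues.
\<close>

definition vertex_enumeration :: "'a pair_pre_digraph \<Rightarrow> 'a list \<Rightarrow> bool" where
  "vertex_enumeration G vs \<longleftrightarrow> distinct vs \<and> set vs = pverts G"

definition adjacency_matrix :: "'a pair_pre_digraph \<Rightarrow> 'a list \<Rightarrow> complex mat" where
  "adjacency_matrix G vs =
     mat (length vs) (length vs) (\<lambda>(i, j). adj G (vs ! i) (vs ! j))"

definition seidel_matrix :: "'a pair_pre_digraph \<Rightarrow> 'a list \<Rightarrow> complex mat" where
  "seidel_matrix G vs =
     \<i> \<cdot>\<^sub>m (adjacency_matrix G vs - transpose_mat (adjacency_matrix G vs))"

text \<open>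
  Only used for Hermitian matrices of positive dimension: all eigenvalues are then real,
  and the set below is finite and nonempty.
\<close>

definition max_eigenvalue :: "complex mat \<Rightarrow> real" where
  "max_eigenvalue M = Max {t. eigenvalue M (complex_of_real t)}"

end

(*
  Let M = A - A^T, with A the adjacency matrix of G, so that the Seidel matrix is i M. Its
  quadratic form attains a maximum on the unit sphere, at an eigenvector, so it is bounded by
  theta_max |x|^2. Evaluating it at p + i c M p for real p and varying c gives |M p| <= theta_max |p|. By
  regularity M kills the all-one vector, so p may be taken as the indicator vector of the
  subtournament minus its mean s/v: this has |p|^2 = s - s^2/v, while the entries of M p on the
  subtournament are the score differences s-1, s-3, ..., 1-s, whose squares add up to s(s^2-1)/3.
  Hence v(s^2-1) <= 3 theta_max^2 (v-s), and the claim is the root of this quadratic in s.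
*)

theory Submission
  imports Defs "HOL-Analysis.Function_Topology" "HOL-Analysis.Topology_Euclidean_Space"
begin

section \<open>Positive semidefinite forms and the Rayleigh maximum\<close>

text \<open>A zero of a nonnegative form is a minimum, so the first variation vanishes there. Moving
  from \<open>x\<close> along \<open>- t * r\<close> with \<open>r = G x\<close> changes the form by
  \<open>- 2 * t * N\<close> plus a multiple of \<open>t\<close> squared, where \<open>N\<close> is
  the squared norm of \<open>r\<close>; for small positive \<open>t\<close> this is negative unless
  \<open>r\<close> vanishes.\<close>

lemma psd_null_vector:
  fixes G :: "'i \<Rightarrow> 'i \<Rightarrow> complex"
  assumes "finite I"
    and herm: "\<And>i j. i \<in> I \<Longrightarrow> j \<in> I \<Longrightarrow> G j i = cnj (G i j)"
    and psd: "\<And>y. 0 \<le> Re (\<Sum>i\<in>I. cnj (y i) * (\<Sum>j\<in>I. G i j * y j))"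
    and null: "Re (\<Sum>i\<in>I. cnj (x i) * (\<Sum>j\<in>I. G i j * x j)) = 0"
    and "i \<in> I"
  shows "(\<Sum>j\<in>I. G i j * x j) = 0"
proof -
  define B where "B x y = (\<Sum>i\<in>I. cnj (x i) * (\<Sum>j\<in>I. G i j * y j))" for x y
  define r where "r i = (\<Sum>j\<in>I. G i j * x j)" for i
  define N where "N = (\<Sum>i\<in>I. (cmod (r i))\<^sup>2)"
  have B_cnj: "B y z = cnj (B z y)" for y z
  proof -
    have "B y z = (\<Sum>i\<in>I. \<Sum>j\<in>I. cnj (y i) * G i j * z j)"
      by (simp add: B_def sum_distrib_left mult.assoc)
    also have "\<dots> = (\<Sum>j\<in>I. \<Sum>i\<in>I. cnj (y i) * G i j * z j)"
      by (rule sum.swap)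
    also have "\<dots> = (\<Sum>j\<in>I. \<Sum>i\<in>I. cnj (cnj (z j) * G j i * y i))"
    proof (intro sum.cong refl)
      fix j i assume "j \<in> I" "i \<in> I"
      then have "G i j = cnj (G j i)" by (intro herm)
      then show "cnj (y i) * G i j * z j = cnj (cnj (z j) * G j i * y i)"
        by (simp only: complex_cnj_mult complex_cnj_cnj mult_ac)
    qed
    also have "\<dots> = cnj (B z y)"
      by (simp add: B_def sum_distrib_left mult.assoc)
    finally show ?thesis .
  qed
  have B_r: "B r x = of_real N"
    unfolding B_def N_def of_real_sum r_def[symmetric]
    by (intro sum.cong refl) (simp only: mult.commute[of "cnj _"] complex_norm_square)
  have expand: "Re (B (\<lambda>i. x i - of_real t * r i) (\<lambda>i. x i - of_real t * r i)) =
      - 2 * t * N + t\<^sup>2 * Re (B r r)" for t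
  proof -
    have "B (\<lambda>i. x i - of_real t * r i) (\<lambda>i. x i - of_real t * r i) =
        B x x - of_real t * B r x - of_real t * B x r + of_real (t\<^sup>2) * B r r"
      by (simp add: B_def algebra_simps sum_distrib_left sum_subtractf sum.distrib power2_eq_square)
    then show ?thesis
      using null B_cnj[of x r] B_r by (simp add: B_def[of x x])
  qed
  have main: "0 \<le> - 2 * t * N + t\<^sup>2 * Re (B r r)" for t
    using psd[of "\<lambda>i. x i - of_real t * r i"] unfolding B_def[symmetric] expand .
  have "N = 0"
  proof (rule ccontr)
    assume "N \<noteq> 0"
    moreover have "N \<ge> 0"
      by (simp add: N_def sum_nonneg)
    ultimately have "N > 0" by simp
    define b where "b = Re (B r r)"
    have "b \<ge> 0" using psd[of r] by (simp add: b_def B_def)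
    \<comment> \<open>Any positive \<open>t\<close> with \<open>t * b < 2 * N\<close> gives the
      contradiction; the \<open>+ 1\<close> keeps the denominator positive when
      \<open>b = 0\<close>.\<close>
    define t where "t = N / (b + 1)"
    have "t > 0" using \<open>N > 0\<close> \<open>b \<ge> 0\<close> by (simp add: t_def)
    have "0 \<le> t * (t * b - 2 * N)"
      using main[of t] by (simp add: b_def algebra_simps power2_eq_square)
    then have "2 * N \<le> t * b"
      using \<open>t > 0\<close> by (simp add: zero_le_mult_iff)
    also have "t * b \<le> t * (b + 1)"
      using \<open>t > 0\<close> by simp
    also have "\<dots> = N"
      using \<open>b \<ge> 0\<close> by (simp add: t_def)
    finally show False using \<open>N > 0\<close> by simp
  qed
  then have "cmod (r i) = 0"
    using assms(1,5) by (simp add: N_def sum_nonneg_eq_0_iff)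
  then show ?thesis by (simp add: r_def)
qed

text \<open>Compactness provides a maximiser \<open>x\<close> of the form on the unit sphere, with
  value \<open>m\<close>. Then m I - H is positive semidefinite and its form vanishes at
  \<open>x\<close>, so \<open>psd_null_vector\<close> shows that \<open>x\<close> is an eigenvector
  for \<open>m\<close>.\<close>

lemma hermitian_top_eigenvector:
  fixes H :: "'i \<Rightarrow> 'i \<Rightarrow> complex"
  assumes "finite I" "I \<noteq> {}"
    and herm: "\<And>i j. i \<in> I \<Longrightarrow> j \<in> I \<Longrightarrow> H j i = cnj (H i j)"
  obtains m x where "\<exists>i\<in>I. x i \<noteq> 0"
    and "\<And>i. i \<in> I \<Longrightarrow> (\<Sum>j\<in>I. H i j * x j) = of_real m * x i"
    and "\<And>y. Re (\<Sum>i\<in>I. cnj (y i) * (\<Sum>j\<in>I. H i j * y j)) \<le> m * (\<Sum>i\<in>I. (cmod (y i))\<^sup>2)"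
proof -
  define q where "q y = Re (\<Sum>i\<in>I. cnj (y i) * (\<Sum>j\<in>I. H i j * y j))" for y
  define n where "n y = (\<Sum>i\<in>I. (cmod (y i))\<^sup>2)" for y :: "'i \<Rightarrow> complex"
  \<comment> \<open>Vectors are functions on the whole type \<open>'i\<close>, which may be
    infinite. Pinning the coordinates outside \<open>I\<close> to 0 makes \<open>C\<close> a product
    of compact sets, hence compact in the product topology, and \<open>K\<close> is the unit sphere
    inside it.\<close>
  define C where "C = (\<Pi>\<^sub>E i\<in>UNIV. if i \<in> I then cball (0::complex) 1 else {0})"
  define K where "K = C \<inter> n -` {1}"
  have cont_n: "continuous_on UNIV n"
    unfolding n_def by (intro continuous_intros continuous_on_product_coordinates)
  have cont_q: "continuous_on A q" for A
    unfolding q_def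
    by (intro continuous_intros continuous_on_subset[OF continuous_on_product_coordinates]) auto
  have "compactin (product_topology (\<lambda>i::'i. euclidean) UNIV) C"
    unfolding C_def compactin_PiE by auto
  then have "compact C"
    by (simp add: euclidean_product_topology)
  moreover have "closed (n -` {1})"
    using continuous_on_closed_vimage[OF closed_UNIV, of n] cont_n by auto
  ultimately have "compact K"
    unfolding K_def by (rule compact_Int_closed)
  have K_I: "y \<in> K" if "n y = 1" "\<And>i. i \<notin> I \<Longrightarrow> y i = 0" for y
  proof -
    have "cmod (y i) \<le> 1" if "i \<in> I" for i
    proof -
      have "(cmod (y i))\<^sup>2 \<le> n y"
        unfolding n_def using \<open>finite I\<close> that by (intro member_le_sum) auto
      with \<open>n y = 1\<close> show ?thesis by (simp add: power_le_one_iff abs_square_le_1)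
    qed
    with that show ?thesis by (auto simp: K_def C_def)
  qed
  obtain i0 where "i0 \<in> I" using \<open>I \<noteq> {}\<close> by blast
  have "n (\<lambda>i. if i = i0 then 1 else 0) = (\<Sum>i\<in>I. if i = i0 then 1 else 0)"
    unfolding n_def by (intro sum.cong) auto
  then have "(\<lambda>i. if i = i0 then 1 else 0) \<in> K"
    using \<open>i0 \<in> I\<close> \<open>finite I\<close> by (intro K_I) auto
  then obtain x where "x \<in> K" and max: "\<And>y. y \<in> K \<Longrightarrow> q y \<le> q x"
    using continuous_attains_sup[OF \<open>compact K\<close> _ cont_q] by blast
  define m where "m = q x"
  have "n x = 1" using \<open>x \<in> K\<close> by (simp add: K_def)
  have bound: "q y \<le> m * n y" for y
  proof (cases "n y = 0")
    case True
    then have "\<forall>i\<in>I. y i = 0"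
      using \<open>finite I\<close> by (simp add: n_def sum_nonneg_eq_0_iff)
    then show ?thesis using True by (simp add: q_def)
  next
    case False
    moreover have "n y \<ge> 0" by (simp add: n_def sum_nonneg)
    ultimately have "n y > 0" by simp
    define r where "r = sqrt (n y)"
    have r: "r > 0" "r\<^sup>2 = n y" using \<open>n y > 0\<close> by (auto simp: r_def)
    \<comment> \<open>The normalised vector must also be cut off outside \<open>I\<close> to lie in
      \<open>K\<close>; neither \<open>q\<close> nor \<open>n\<close> sees those
      coordinates.\<close>
    define z where "z i = (if i \<in> I then y i / of_real r else 0)" for i
    have "n z = n y / r\<^sup>2"
      unfolding n_def sum_divide_distrib
      by (intro sum.cong) (use r in \<open>auto simp: z_def norm_divide power_divide\<close>)
    then have "z \<in> K" using r \<open>n y > 0\<close> by (intro K_I) (auto simp: z_def)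
    have "q z = Re ((\<Sum>i\<in>I. cnj (y i) * (\<Sum>j\<in>I. H i j * y j)) / of_real (r\<^sup>2))"
      unfolding q_def by (simp add: z_def sum_divide_distrib sum_distrib_left power2_eq_square)
    also have "\<dots> = q y / n y"
      unfolding q_def r(2) by (rule Re_divide_of_real)
    finally have "q y / n y \<le> m" using max[OF \<open>z \<in> K\<close>] by (simp add: m_def)
    then show ?thesis using \<open>n y > 0\<close> by (simp add: field_simps)
  qed
  \<comment> \<open>The matrix m I - H: its form is \<open>m * n y - q y\<close>, nonnegative by
    \<open>bound\<close> and zero at \<open>x\<close> because \<open>n x = 1\<close>.\<close>
  define G where "G i j = (if i = j then of_real m else 0) - H i j" for i j
  have G_sum: "(\<Sum>j\<in>I. G i j * y j) = of_real m * y i - (\<Sum>j\<in>I. H i j * y j)"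
    if "i \<in> I" for i y
  proof -
    have "(\<Sum>j\<in>I. (if i = j then of_real m else 0) * y j) =
        (\<Sum>j\<in>I. if i = j then of_real m * y j else 0)"
      by (intro sum.cong) auto
    then show ?thesis
      using that \<open>finite I\<close> by (simp add: G_def left_diff_distrib sum_subtractf)
  qed
  have G_form: "Re (\<Sum>i\<in>I. cnj (y i) * (\<Sum>j\<in>I. G i j * y j)) = m * n y - q y" for y
  proof -
    have "(\<Sum>i\<in>I. cnj (y i) * (\<Sum>j\<in>I. G i j * y j)) =
        (\<Sum>i\<in>I. of_real (m * (cmod (y i))\<^sup>2) - cnj (y i) * (\<Sum>j\<in>I. H i j * y j))"
      by (intro sum.cong refl)
        (simp add: G_sum right_diff_distrib complex_norm_square mult.left_commute
          mult.commute[of "cnj _"] del: of_real_power)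
    then show ?thesis
      by (simp add: sum_subtractf n_def q_def sum_distrib_left)
  qed
  have "(\<Sum>j\<in>I. G i j * x j) = 0" if "i \<in> I" for i
  proof (rule psd_null_vector[OF \<open>finite I\<close> _ _ _ that])
    show "G j i = cnj (G i j)" if "i \<in> I" "j \<in> I" for i j
      using herm[OF that] by (simp add: G_def)
    show "0 \<le> Re (\<Sum>i\<in>I. cnj (y i) * (\<Sum>j\<in>I. G i j * y j))" for y
      using bound[of y] unfolding G_form by simp
    show "Re (\<Sum>i\<in>I. cnj (x i) * (\<Sum>j\<in>I. G i j * x j)) = 0"
      unfolding G_form by (simp add: m_def \<open>n x = 1\<close>)
  qed
  then have "(\<Sum>j\<in>I. H i j * x j) = of_real m * x i" if "i \<in> I" for i
    using G_sum[OF that, of x] that by simp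
  moreover have "\<exists>i\<in>I. x i \<noteq> 0"
  proof (rule ccontr)
    assume "\<not> ?thesis"
    then have "n x = 0" by (simp add: n_def)
    then show False using \<open>n x = 1\<close> by simp
  qed
  ultimately show thesis
    using that bound unfolding q_def n_def by blast
qed

section \<open>The Seidel matrix and its largest eigenvalue\<close>

text \<open>The real skew-symmetric matrix M whose multiple by the imaginary unit is the Seidel
  matrix. Indexing by vertices instead of list positions keeps the later sums free of the
  enumeration. Loops and pairs of opposite arcs cancel.\<close>

definition skew_adj :: "'a pair_pre_digraph \<Rightarrow> 'a \<Rightarrow> 'a \<Rightarrow> real" where
  "skew_adj G x y = of_bool ((x, y) \<in> parcs G) - of_bool ((y, x) \<in> parcs G)"

lemma skew_adj_commute: "skew_adj G y x = - skew_adj G x y"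
  by (simp add: skew_adj_def)

lemma seidel_matrix_carrier: "seidel_matrix G vs \<in> carrier_mat (length vs) (length vs)"
  by (auto simp: seidel_matrix_def adjacency_matrix_def)

lemma seidel_matrix_index:
  assumes "i < length vs" "j < length vs"
  shows "seidel_matrix G vs $$ (i, j) = \<i> * of_real (skew_adj G (vs ! i) (vs ! j))"
  using assms by (simp add: seidel_matrix_def adjacency_matrix_def adj_def skew_adj_def)

text \<open>The bridge from vertex-indexed sums to library matrices: reading an eigenvector along
  \<open>vs\<close> only reindexes each sum by the bijection between positions and vertices.\<close>

lemma eigenvalue_seidel_matrix:
  assumes vs: "vertex_enumeration G vs"
    and nz: "\<exists>u\<in>pverts G. x u \<noteq> 0"
    and eig: "\<And>u. u \<in> pverts G \<Longrightarrow>
      (\<Sum>w\<in>pverts G. \<i> * of_real (skew_adj G u w) * x w) = c * x u"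
  shows "eigenvalue (seidel_matrix G vs) c"
proof -
  let ?n = "length vs" and ?S = "seidel_matrix G vs"
  define X where "X = Matrix.vec ?n (\<lambda>i. x (vs ! i))"
  have bij: "bij_betw ((!) vs) {0..<?n} (pverts G)"
    using vs by (intro bij_betw_nth) (auto simp: vertex_enumeration_def lessThan_atLeast0)
  have "?S *\<^sub>v X = c \<cdot>\<^sub>v X"
  proof (rule eq_vecI)
    fix i assume "i < dim_vec (c \<cdot>\<^sub>v X)"
    then have i: "i < ?n" by (simp add: X_def)
    then have "(?S *\<^sub>v X) $ i =
        (\<Sum>j\<in>{0..<?n}. \<i> * of_real (skew_adj G (vs ! i) (vs ! j)) * x (vs ! j))"
      using seidel_matrix_carrier[of G vs]
      by (auto simp: scalar_prod_def X_def seidel_matrix_index intro!: sum.cong)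
    also have "\<dots> = (\<Sum>w\<in>pverts G. \<i> * of_real (skew_adj G (vs ! i) w) * x w)"
      by (rule sum.reindex_bij_betw[OF bij])
    also have "\<dots> = c * x (vs ! i)"
    proof (rule eig)
      show "vs ! i \<in> pverts G"
        using vs nth_mem[OF i] by (simp add: vertex_enumeration_def)
    qed
    finally show "(?S *\<^sub>v X) $ i = (c \<cdot>\<^sub>v X) $ i"
      using i by (simp add: X_def)
  qed (use seidel_matrix_carrier[of G vs] in \<open>auto simp: X_def\<close>)
  moreover have "X \<noteq> 0\<^sub>v ?n"
  proof
    assume "X = 0\<^sub>v ?n"
    then have "x (vs ! i) = 0" if "i < ?n" for i
      using that by (metis X_def index_vec index_zero_vec(1))
    with nz vs show False
      by (metis in_set_conv_nth vertex_enumeration_def)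
  qed
  ultimately show ?thesis
    using seidel_matrix_carrier[of G vs]
    unfolding eigenvalue_def eigenvector_def by (auto intro!: exI[of _ X] simp: X_def)
qed

text \<open>\<open>Max\<close> bounds its elements only for a finite set. Finiteness holds because
  the eigenvalues are the roots of a nonzero characteristic polynomial and the embedding of the
  reals is injective.\<close>

lemma eigenvalue_le_max_eigenvalue:
  assumes M: "M \<in> carrier_mat n n" and "eigenvalue M (complex_of_real t)"
  shows "t \<le> max_eigenvalue M"
proof -
  have "char_poly M \<noteq> 0"
    using degree_monic_char_poly[OF M] by auto
  then have "finite {c. eigenvalue M c}"
    using poly_roots_finite[of "char_poly M"] by (simp add: eigenvalue_root_char_poly[OF M])
  then have "finite (complex_of_real -` {c. eigenvalue M c})"
    by (rule finite_vimageI) (simp add: inj_def)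
  then show ?thesis
    using assms(2) by (auto simp: max_eigenvalue_def vimage_def intro: Max_ge)
qed

text \<open>The best constant \<open>m\<close> in this bound is itself an eigenvalue of the Seidel
  matrix, hence at most its maximum eigenvalue. For an empty vertex set both sides are 0.\<close>

lemma seidel_form_le:
  assumes fin: "finite (pverts G)" and vs: "vertex_enumeration G vs"
  shows "Re (\<Sum>u\<in>pverts G. cnj (y u) * (\<Sum>w\<in>pverts G. \<i> * of_real (skew_adj G u w) * y w))
    \<le> max_eigenvalue (seidel_matrix G vs) * (\<Sum>u\<in>pverts G. (cmod (y u))\<^sup>2)"
proof (cases "pverts G = {}")
  case False
  obtain m x where nz: "\<exists>u\<in>pverts G. x u \<noteq> 0"
    and eig: "\<And>u. u \<in> pverts G \<Longrightarrow>
      (\<Sum>w\<in>pverts G. \<i> * of_real (skew_adj G u w) * x w) = of_real m * x u"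
    and bound: "\<And>y. Re (\<Sum>u\<in>pverts G. cnj (y u) *
        (\<Sum>w\<in>pverts G. \<i> * of_real (skew_adj G u w) * y w))
      \<le> m * (\<Sum>u\<in>pverts G. (cmod (y u))\<^sup>2)"
  proof (rule hermitian_top_eigenvector[OF fin False,
        of "\<lambda>u w. \<i> * of_real (skew_adj G u w)"])
    show "\<i> * of_real (skew_adj G w u) = cnj (\<i> * of_real (skew_adj G u w))" for u w
      by (subst skew_adj_commute) simp
  qed blast
  have "m \<le> max_eigenvalue (seidel_matrix G vs)"
    by (rule eigenvalue_le_max_eigenvalue[OF seidel_matrix_carrier
          eigenvalue_seidel_matrix[OF vs nz eig]])
  then have "m * (\<Sum>u\<in>pverts G. (cmod (y u))\<^sup>2) \<le>
      max_eigenvalue (seidel_matrix G vs) * (\<Sum>u\<in>pverts G. (cmod (y u))\<^sup>2)"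
    by (intro mult_right_mono sum_nonneg) auto
  with bound show ?thesis by (rule order_trans)
qed simp

text \<open>An upper bound on the Hermitian form becomes a norm bound on M. Real vectors alone would
  give nothing, since the form of i M vanishes on them; the imaginary part of the test vector brings
  in |M p|.\<close>

lemma skew_adj_norm_le:
  fixes p :: "'a \<Rightarrow> real"
  assumes fin: "finite (pverts G)" and vs: "vertex_enumeration G vs"
  shows "(\<Sum>u\<in>pverts G. (\<Sum>w\<in>pverts G. skew_adj G u w * p w)\<^sup>2)
    \<le> (max_eigenvalue (seidel_matrix G vs))\<^sup>2 * (\<Sum>u\<in>pverts G. (p u)\<^sup>2)"
proof -
  let ?V = "pverts G" and ?\<theta> = "max_eigenvalue (seidel_matrix G vs)"
  define r where "r u = (\<Sum>w\<in>?V. skew_adj G u w * p w)" for u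
  define N where "N = (\<Sum>u\<in>?V. (r u)\<^sup>2)"
  define P where "P = (\<Sum>u\<in>?V. (p u)\<^sup>2)"
  have skew: "(\<Sum>u\<in>?V. p u * (\<Sum>w\<in>?V. skew_adj G u w * r w)) = - N"
  proof -
    have "(\<Sum>u\<in>?V. p u * (\<Sum>w\<in>?V. skew_adj G u w * r w)) =
        (\<Sum>u\<in>?V. \<Sum>w\<in>?V. p u * skew_adj G u w * r w)"
      by (simp add: sum_distrib_left mult.assoc)
    also have "\<dots> = (\<Sum>w\<in>?V. \<Sum>u\<in>?V. p u * skew_adj G u w * r w)"
      by (rule sum.swap)
    also have "\<dots> = (\<Sum>w\<in>?V. - (r w * r w))"
    proof (rule sum.cong[OF refl])
      fix w
      have "(\<Sum>u\<in>?V. p u * skew_adj G u w * r w) = (\<Sum>u\<in>?V. - (skew_adj G w u * p u) * r w)"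
        by (intro sum.cong refl) (simp add: skew_adj_commute[of G _ w])
      then show "(\<Sum>u\<in>?V. p u * skew_adj G u w * r w) = - (r w * r w)"
        by (simp only: sum_negf r_def[of w] flip: sum_distrib_right)
    qed
    finally show ?thesis by (simp add: N_def power2_eq_square sum_negf)
  qed
  \<comment> \<open>With y = p + i c r and r = M p, the form is c |r|^2 - c <p, M r>, and
    \<open>skew\<close> turns the second term into another \<open>c * N\<close>.\<close>
  have key: "2 * c * N \<le> ?\<theta> * (P + c\<^sup>2 * N)" for c
  proof -
    define y where "y u = Complex (p u) (c * r u)" for u
    have inner: "(\<Sum>w\<in>?V. \<i> * of_real (skew_adj G u w) * y w) =
        Complex (- c * (\<Sum>w\<in>?V. skew_adj G u w * r w)) (r u)" for u
      by (simp add: complex_eq_iff y_def r_def[of u] sum_distrib_left sum_negf mult_ac)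
    have "Re (\<Sum>u\<in>?V. cnj (y u) * (\<Sum>w\<in>?V. \<i> * of_real (skew_adj G u w) * y w)) =
        (\<Sum>u\<in>?V. c * (r u)\<^sup>2 - c * (p u * (\<Sum>w\<in>?V. skew_adj G u w * r w)))"
      unfolding inner Re_sum
      by (intro sum.cong refl) (simp add: y_def power2_eq_square mult_ac)
    also have "\<dots> = 2 * c * N"
      by (simp add: sum_subtractf skew N_def flip: sum_distrib_left)
    finally have "2 * c * N \<le> ?\<theta> * (\<Sum>u\<in>?V. (cmod (y u))\<^sup>2)"
      using seidel_form_le[OF assms, of y] by simp
    also have "(\<Sum>u\<in>?V. (cmod (y u))\<^sup>2) = P + c\<^sup>2 * N"
      by (simp add: y_def cmod_power2 power_mult_distrib sum.distrib P_def N_def sum_distrib_left)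
    finally show ?thesis .
  qed
  have "N \<ge> 0" "P \<ge> 0" by (auto simp: N_def P_def sum_nonneg)
  have "N \<le> ?\<theta>\<^sup>2 * P"
  proof (cases "N = 0")
    case True
    then show ?thesis using \<open>P \<ge> 0\<close> by simp
  next
    case False
    then have "N > 0" using \<open>N \<ge> 0\<close> by simp
    \<comment> \<open>Taking \<open>c = 1\<close> forces the eigenvalue to be positive, which
      permits the division by it below.\<close>
    then have "0 < ?\<theta> * (P + N)" using key[of 1] by simp
    then have "?\<theta> > 0" using \<open>N > 0\<close> \<open>P \<ge> 0\<close> by (simp add: zero_less_mult_iff)
    \<comment> \<open>The choice \<open>c = 1 / ?\<theta>\<close> is optimal, as it maximises
      \<open>2 * c * N - ?\<theta> * c\<^sup>2 * N\<close>.\<close>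
    have "2 * (1 / ?\<theta>) * N * ?\<theta> \<le> ?\<theta> * (P + (1 / ?\<theta>)\<^sup>2 * N) * ?\<theta>"
      using key[of "1 / ?\<theta>"] \<open>?\<theta> > 0\<close> by (intro mult_right_mono) auto
    then show ?thesis
      using \<open>?\<theta> > 0\<close> by (simp add: field_simps power2_eq_square)
  qed
  then show ?thesis by (simp add: N_def P_def r_def)
qed

section \<open>Score differences in regular digraphs and transitive tournaments\<close>

lemma skew_adj_total: "(\<Sum>x\<in>W. \<Sum>y\<in>W. skew_adj G x y) = 0"
proof -
  have "(\<Sum>x\<in>W. \<Sum>y\<in>W. skew_adj G x y) = (\<Sum>y\<in>W. \<Sum>x\<in>W. - skew_adj G y x)"
    by (subst sum.swap) (intro sum.cong refl skew_adj_commute)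
  then show ?thesis by (simp add: sum_negf)
qed

lemma skew_adj_row_sum:
  assumes "finite (pverts G)" "regular_digraph G" "x \<in> pverts G"
  shows "(\<Sum>y\<in>pverts G. skew_adj G x y) = 0"
proof -
  have "(\<Sum>y\<in>pverts G. skew_adj G x y) =
      real (card {y \<in> pverts G. (x, y) \<in> parcs G}) - real (card {y \<in> pverts G. (y, x) \<in> parcs G})"
    using assms(1) by (simp add: skew_adj_def sum_subtractf of_bool_def sum.If_cases Int_def)
  then show ?thesis
    using assms(2,3) unfolding regular_digraph_def by fastforce
qed

text \<open>Induction by deleting a source. With k vertices left, the source has score difference k
  and every other vertex loses 1. The linear terms cancel by \<open>skew_adj_total\<close>, so the
  sum of squares grows by k^2 + k, the increment of s(s^2-1)/3 from s = k to s = k + 1.\<close>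

lemma transitive_score_squares:
  fixes G :: "'a pair_pre_digraph"
  assumes "finite W"
    and total: "\<And>x y. x \<in> W \<Longrightarrow> y \<in> W \<Longrightarrow> x \<noteq> y \<Longrightarrow>
      (x, y) \<in> parcs G \<longleftrightarrow> (y, x) \<notin> parcs G"
    and trans: "\<And>x y z. x \<in> W \<Longrightarrow> y \<in> W \<Longrightarrow> z \<in> W \<Longrightarrow> x \<noteq> y \<Longrightarrow> y \<noteq> z \<Longrightarrow> x \<noteq> z \<Longrightarrow>
      (x, y) \<in> parcs G \<Longrightarrow> (y, z) \<in> parcs G \<Longrightarrow> (x, z) \<in> parcs G"
  shows "3 * (\<Sum>x\<in>W. (\<Sum>y\<in>W. skew_adj G x y)\<^sup>2) = real (card W) * ((real (card W))\<^sup>2 - 1)"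
  using assms
proof (induction "card W" arbitrary: W)
  case 0
  then have "W = {}" by (metis card_0_eq)
  then show ?case by simp
next
  case (Suc k)
  have "W \<noteq> {}" using Suc.hyps(2) by auto
  \<comment> \<open>Excluding \<open>x = y\<close> makes \<open>R\<close> a strict order even if
    \<open>G\<close> has loops. A minimal element is then a source, because any two distinct
    vertices of \<open>W\<close> are joined by exactly one arc.\<close>
  define R where "R x y \<longleftrightarrow> x \<noteq> y \<and> (x, y) \<in> parcs G" for x y
  have "asymp_on W R"
    using Suc.prems(2) unfolding asymp_on_def R_def by blast
  moreover have "transp_on W R"
    using Suc.prems(2,3) unfolding transp_on_def R_def by metis
  ultimately obtain a where a: "a \<in> W" "\<And>x. x \<in> W \<Longrightarrow> x \<noteq> a \<Longrightarrow> \<not> R x a"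
    using Finite_Set.bex_min_element[OF Suc.prems(1) _ _ \<open>W \<noteq> {}\<close>] by blast
  define U where "U = W - {a}"
  have W: "W = insert a U" "a \<notin> U" "finite U" "card U = k"
    using a Suc.prems(1) Suc.hyps(2) by (auto simp: U_def)
  define d where "d x = (\<Sum>y\<in>U. skew_adj G x y)" for x
  have source: "skew_adj G a x = 1" if "x \<in> U" for x
    using a that Suc.prems(2)[of x a] by (auto simp: U_def R_def skew_adj_def)
  have loop: "skew_adj G a a = 0"
    by (simp add: skew_adj_def)
  have IH: "3 * (\<Sum>x\<in>U. (d x)\<^sup>2) = real k * ((real k)\<^sup>2 - 1)"
    unfolding d_def W(4)[symmetric]
    by (rule Suc.hyps(1)) (use W Suc.prems(2,3) in \<open>blast+\<close>)
  have "(\<Sum>x\<in>U. (\<Sum>y\<in>W. skew_adj G x y)\<^sup>2) = (\<Sum>x\<in>U. (d x)\<^sup>2 - 2 * d x + 1)"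
  proof (rule sum.cong[OF refl])
    fix x assume "x \<in> U"
    then have "(\<Sum>y\<in>W. skew_adj G x y) = d x - 1"
      using W source by (simp add: d_def skew_adj_commute[of G x a])
    then show "(\<Sum>y\<in>W. skew_adj G x y)\<^sup>2 = (d x)\<^sup>2 - 2 * d x + 1"
      by (simp only: power2_diff) simp
  qed
  also have "\<dots> = (\<Sum>x\<in>U. (d x)\<^sup>2) - 2 * (\<Sum>x\<in>U. d x) + real k"
    using W by (simp add: sum.distrib sum_subtractf sum_distrib_left)
  also have "(\<Sum>x\<in>U. d x) = 0"
    unfolding d_def by (rule skew_adj_total)
  finally have "(\<Sum>x\<in>U. (\<Sum>y\<in>W. skew_adj G x y)\<^sup>2) = (\<Sum>x\<in>U. (d x)\<^sup>2) + real k"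
    by simp
  moreover have "(\<Sum>y\<in>W. skew_adj G a y) = real k"
    using W source loop by simp
  ultimately have "(\<Sum>x\<in>W. (\<Sum>y\<in>W. skew_adj G x y)\<^sup>2) =
      (real k)\<^sup>2 + (\<Sum>x\<in>U. (d x)\<^sup>2) + real k"
    unfolding W(1) using W(2,3) by simp
  then have "3 * (\<Sum>x\<in>W. (\<Sum>y\<in>W. skew_adj G x y)\<^sup>2) =
      3 * (real k)\<^sup>2 + real k * ((real k)\<^sup>2 - 1) + 3 * real k"
    using IH by simp
  then show ?case
    unfolding Suc.hyps(2)[symmetric] by (simp add: power2_eq_square algebra_simps)
qed

text \<open>As the subgraph is induced, \<open>G\<close> and \<open>\<Gamma>\<close> have the same
  arcs between vertices of \<open>\<Gamma>\<close>, so the tournament laws of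
  \<open>\<Gamma>\<close> apply to \<open>skew_adj G\<close>.\<close>

lemma transitive_subtournament_score_squares:
  assumes fin: "finite (pverts G)" and "transitive_subtournament \<Gamma> G"
  shows "3 * (\<Sum>x\<in>pverts \<Gamma>. (\<Sum>y\<in>pverts \<Gamma>. skew_adj G x y)\<^sup>2) =
    real (card (pverts \<Gamma>)) * ((real (card (pverts \<Gamma>)))\<^sup>2 - 1)"
    and "pverts \<Gamma> \<subseteq> pverts G"
proof -
  have sub: "subgraph (with_proj \<Gamma>) (with_proj G)"
    and arcs: "parcs \<Gamma> = {e \<in> parcs G. fst e \<in> pverts \<Gamma> \<and> snd e \<in> pverts \<Gamma>}"
    and tt: "transitive_tournament \<Gamma>"
    using assms(2) by (auto simp: transitive_subtournament_def induced_subgraph_def)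
  show W: "pverts \<Gamma> \<subseteq> pverts G"
    using sub by (auto simp: subgraph_def)
  have in_arcs: "(x, y) \<in> parcs G \<longleftrightarrow> (x, y) \<in> parcs \<Gamma>"
    if "x \<in> pverts \<Gamma>" "y \<in> pverts \<Gamma>" for x y
    using that arcs by auto
  show "3 * (\<Sum>x\<in>pverts \<Gamma>. (\<Sum>y\<in>pverts \<Gamma>. skew_adj G x y)\<^sup>2) =
    real (card (pverts \<Gamma>)) * ((real (card (pverts \<Gamma>)))\<^sup>2 - 1)"
  proof (rule transitive_score_squares)
    show "finite (pverts \<Gamma>)" using W fin by (rule finite_subset)
    show "(x, y) \<in> parcs G \<longleftrightarrow> (y, x) \<notin> parcs G"
      if "x \<in> pverts \<Gamma>" "y \<in> pverts \<Gamma>" "x \<noteq> y" for x y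
    proof -
      have "adj \<Gamma> x y + adj \<Gamma> y x = 1"
        using tt that by (auto simp: transitive_tournament_def tournament_def)
      then show ?thesis
        using that by (auto simp: in_arcs adj_def split: if_splits)
    qed
    show "(x, z) \<in> parcs G"
      if "x \<in> pverts \<Gamma>" "y \<in> pverts \<Gamma>" "z \<in> pverts \<Gamma>" "(x, y) \<in> parcs G" "(y, z) \<in> parcs G"
      for x y z
      using tt that unfolding transitive_tournament_def by (metis in_arcs)
  qed
qed

section \<open>The quadratic inequality and the final bound\<close>

lemma transitive_subtournament_quadratic:
  assumes fin: "finite (pverts G)" and reg: "regular_digraph G"
    and sub: "transitive_subtournament \<Gamma> G" and vs: "vertex_enumeration G vs"
  defines "\<theta> \<equiv> max_eigenvalue (seidel_matrix G vs)"
    and "v \<equiv> real (card (pverts G))" and "s \<equiv> real (card (pverts \<Gamma>))"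
  shows "v * s\<^sup>2 + 3 * \<theta>\<^sup>2 * s \<le> v + 3 * \<theta>\<^sup>2 * v"
proof (cases "s = 0")
  case True
  then show ?thesis by (simp add: v_def)
next
  case False
  let ?V = "pverts G" and ?W = "pverts \<Gamma>"
  have W: "?W \<subseteq> ?V"
    by (rule transitive_subtournament_score_squares(2)[OF fin sub])
  have "s \<le> v" using card_mono[OF fin W] by (simp add: v_def s_def)
  with False have "s > 0" "v > 0" by (auto simp: s_def)
  \<comment> \<open>Row sums of M vanish, so subtracting the mean \<open>s / v\<close> from the
    indicator leaves M p unchanged while lowering the squared norm from \<open>s\<close> to
    \<open>s - s\<^sup>2 / v\<close>.\<close>
  define p where "p x = of_bool (x \<in> ?W) - s / v" for x
  have "(\<Sum>x\<in>?W. (\<Sum>y\<in>?W. skew_adj G x y)\<^sup>2) = (\<Sum>x\<in>?W. (\<Sum>y\<in>?V. skew_adj G x y * p y)\<^sup>2)"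
  proof (rule sum.cong[OF refl])
    fix x assume "x \<in> ?W"
    have "(\<Sum>y\<in>?V. skew_adj G x y * p y) =
        (\<Sum>y\<in>?V. skew_adj G x y * of_bool (y \<in> ?W)) - (\<Sum>y\<in>?V. skew_adj G x y) * (s / v)"
      by (simp only: p_def right_diff_distrib sum_subtractf sum_distrib_right)
    also have "(\<Sum>y\<in>?V. skew_adj G x y) = 0"
      using fin reg \<open>x \<in> ?W\<close> W by (intro skew_adj_row_sum) auto
    also have "(\<Sum>y\<in>?V. skew_adj G x y * of_bool (y \<in> ?W)) = (\<Sum>y\<in>?W. skew_adj G x y)"
      using fin W by (intro sum.mono_neutral_cong_right) auto
    finally show "(\<Sum>y\<in>?W. skew_adj G x y)\<^sup>2 = (\<Sum>y\<in>?V. skew_adj G x y * p y)\<^sup>2"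
      by simp
  qed
  \<comment> \<open>Rows outside the subtournament contribute only nonnegative squares.\<close>
  also have "\<dots> \<le> (\<Sum>x\<in>?V. (\<Sum>y\<in>?V. skew_adj G x y * p y)\<^sup>2)"
    using fin W by (intro sum_mono2) auto
  also have "\<dots> \<le> \<theta>\<^sup>2 * (\<Sum>x\<in>?V. (p x)\<^sup>2)"
    unfolding \<theta>_def by (rule skew_adj_norm_le[OF fin vs])
  also have "(\<Sum>x\<in>?V. (p x)\<^sup>2) = s - s\<^sup>2 / v"
  proof -
    have "(\<Sum>x\<in>?V. (p x)\<^sup>2) = (\<Sum>x\<in>?V. of_bool (x \<in> ?W) * (1 - 2 * (s / v)) + (s / v)\<^sup>2)"
      by (intro sum.cong refl) (auto simp: p_def power2_eq_square algebra_simps)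
    also have "\<dots> = (\<Sum>x\<in>?V. of_bool (x \<in> ?W)) * (1 - 2 * (s / v)) + v * (s / v)\<^sup>2"
      by (simp only: sum.distrib sum_constant v_def flip: sum_distrib_right)
    also have "(\<Sum>x\<in>?V. of_bool (x \<in> ?W)) = s"
      using fin W by (simp add: s_def of_bool_def sum.If_cases Int_absorb1)
    finally show ?thesis
      using \<open>v > 0\<close> by (simp add: field_simps power2_eq_square)
  qed
  finally have "s * (s\<^sup>2 - 1) \<le> 3 * (\<theta>\<^sup>2 * (s - s\<^sup>2 / v))"
    using transitive_subtournament_score_squares(1)[OF fin sub] by (simp add: s_def)
  \<comment> \<open>The factor \<open>v / s\<close> clears the denominator and cancels the common
    factor \<open>s\<close>; this is why \<open>s = 0\<close> was treated apart.\<close>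
  then have "(s * (s\<^sup>2 - 1)) * (v / s) \<le> (3 * (\<theta>\<^sup>2 * (s - s\<^sup>2 / v))) * (v / s)"
    using \<open>s > 0\<close> \<open>v > 0\<close> by (intro mult_right_mono) auto
  moreover have "(s * (s\<^sup>2 - 1)) * (v / s) = v * s\<^sup>2 - v"
    using \<open>s > 0\<close> by (simp add: field_simps)
  moreover have "(3 * (\<theta>\<^sup>2 * (s - s\<^sup>2 / v))) * (v / s) = 3 * \<theta>\<^sup>2 * v - 3 * \<theta>\<^sup>2 * s"
    using \<open>s > 0\<close> \<open>v > 0\<close> by (simp add: field_simps power2_eq_square)
  ultimately show ?thesis by simp
qed

theorem corollary4p4:
  fixes G \<Gamma> :: "'a pair_pre_digraph"
    and vs :: "'a list"
    and v s :: nat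
    and \<theta>max :: real
  assumes "pair_fin_digraph G"
    and "regular_digraph G"
    and "card (pverts G) = v"
    and "transitive_subtournament \<Gamma> G"
    and "card (pverts \<Gamma>) = s"
    and "vertex_enumeration G vs"
    and "\<theta>max = max_eigenvalue (seidel_matrix G vs)"
  shows "real s \<le>
    (- 3 * \<theta>max ^ 2 + sqrt (9 * \<theta>max ^ 4 + 4 * real v ^ 2 + 12 * \<theta>max ^ 2 * real v ^ 2))
      / (2 * real v)"
proof (cases "v = 0")
  case True
  have fin: "finite (pverts G)"
    using assms(1) by (rule pair_fin_digraph.pair_finite_verts)
  have "s \<le> v"
    using card_mono[OF fin transitive_subtournament_score_squares(2)[OF fin assms(4)]] assms(3,5)
    by simp
  \<comment> \<open>Here \<open>s = 0\<close>, and the right-hand side is a division by zero, which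
    has value 0.\<close>
  then show ?thesis using True by simp
next
  case False
  have fin: "finite (pverts G)"
    using assms(1) by (rule pair_fin_digraph.pair_finite_verts)
  have quad: "real v * (real s)\<^sup>2 + 3 * \<theta>max\<^sup>2 * real s \<le> real v + 3 * \<theta>max\<^sup>2 * real v"
    using transitive_subtournament_quadratic[OF fin assms(2,4,6)] assms(3,5,7) by simp
  \<comment> \<open>Completing the square: \<open>quad\<close> multiplied by
    \<open>4 * real v\<close>, with \<open>9 * \<theta>max ^ 4\<close> added to both sides.\<close>
  have "(2 * real v * real s + 3 * \<theta>max\<^sup>2)\<^sup>2 =
      9 * \<theta>max ^ 4 + 4 * real v * (real v * (real s)\<^sup>2 + 3 * \<theta>max\<^sup>2 * real s)"
    by (simp add: power2_eq_square power4_eq_xxxx algebra_simps)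
  also have "\<dots> \<le> 9 * \<theta>max ^ 4 + 4 * real v * (real v + 3 * \<theta>max\<^sup>2 * real v)"
    using quad by (intro add_left_mono mult_left_mono) auto
  also have "\<dots> = 9 * \<theta>max ^ 4 + 4 * real v ^ 2 + 12 * \<theta>max ^ 2 * real v ^ 2"
    by (simp add: power2_eq_square algebra_simps)
  finally have "2 * real v * real s + 3 * \<theta>max\<^sup>2 \<le>
      sqrt (9 * \<theta>max ^ 4 + 4 * real v ^ 2 + 12 * \<theta>max ^ 2 * real v ^ 2)"
    by (rule real_le_rsqrt)
  then show ?thesis using False by (simp add: field_simps)
qed

end
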